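(* Let $n$ be an odd positive integer and let $j$ be a positive integer such that $\gcd(j,n)=1$ and $j(2k+1)$ is not a multiple of $n$ for $0\le k\le \frac{n-3}{2}$. Then $$\sum_{k=0}^{\frac{n-3}{2}} \frac{\sin\left(\frac{(j-1)(2k+1)\pi}{n}\right)\sin\left(\frac{(j+1)(2k+1)\pi}{n}\right)}{\sin^2\left(\frac{(2k+1)\pi}{n}\right)\sin^2\left(\frac{j(2k+1)\pi}{n}\right)}=0.$$
   Context: An empty sum (when $n=1$) equals $0$. *)

theory Defs
  imports Complex_Main
begin

end

theory Submission
  imports Defs
begin

text \<open>Since \<open>sin (A - B) * sin (A + B) = sin\<^sup>2 A - sin\<^sup>2 B\<close>, each summand is the difference of
  \<open>csc\<^sup>2 (m * pi / n)\<close> and \<open>csc\<^sup>2 (j * m * pi / n)\<close> with \<open>m = 2 * k + 1\<close>. Both are invariant under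
  \<open>m \<mapsto> n - m\<close>, which exchanges odd and even residues because \<open>n\<close> is odd, so the sum over odd \<open>m\<close>
  is half the sum over all nonzero residues. The two full sums agree because multiplication by
  \<open>j\<close> permutes the nonzero residues modulo \<open>n\<close>.\<close>

lemma sin_diff_mult_sin_add:
  fixes a b :: real
  shows "sin (a - b) * sin (a + b) = (sin a)\<^sup>2 - (sin b)\<^sup>2"
proof -
  have "sin (a - b) * sin (a + b) = (sin a)\<^sup>2 * (cos b)\<^sup>2 - (cos a)\<^sup>2 * (sin b)\<^sup>2"
    by (simp add: sin_add sin_diff power2_eq_square algebra_simps)
  also have "\<dots> = (sin a)\<^sup>2 - (sin b)\<^sup>2"
    by (simp add: cos_squared_eq algebra_simps)
  finally show ?thesis .
qed

text \<open>A shift by \<open>q * pi\<close> multiplies the sine by \<open>cos (q * pi)\<close>, a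
  sign that squaring removes.\<close>

lemma sin_squared_add_int_pi: "(sin (x + of_int q * pi))\<^sup>2 = (sin x)\<^sup>2"
proof -
  have "sin (of_int q * pi) = 0"
    by (simp add: sin_zero_iff_int2)
  moreover from this have "(cos (of_int q * pi))\<^sup>2 = 1"
    by (simp add: cos_squared_eq)
  ultimately show ?thesis
    by (simp add: sin_add power_mult_distrib)
qed

text \<open>The quotient \<open>m div n\<close> contributes a whole multiple of \<open>pi\<close> to
  the angle. Hence the squared sine depends only on the residue class of \<open>m\<close>, which
  permits reindexing modulo \<open>n\<close>.\<close>

lemma sin_squared_mod:
  fixes n m :: int
  assumes "n \<noteq> 0"
  shows "(sin (of_int (m mod n) * pi / of_int n))\<^sup>2 = (sin (of_int m * pi / of_int n))\<^sup>2"
proof -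
  have "real_of_int m = of_int (m mod n) + of_int (m div n) * of_int n"
    by (metis mod_div_mult_eq of_int_add of_int_mult)
  then have "of_int m * pi / of_int n = of_int (m mod n) * pi / of_int n + of_int (m div n) * pi"
    using assms by (simp add: field_simps)
  then show ?thesis
    by (simp only: sin_squared_add_int_pi)
qed

lemma sin_int_pi_div_eq_0_iff:
  fixes n m :: int
  assumes "n \<noteq> 0"
  shows "sin (of_int m * pi / of_int n) = 0 \<longleftrightarrow> n dvd m"
proof -
  have "of_int m * pi / of_int n = of_int i * pi \<longleftrightarrow> m = i * n" for i :: int
  proof -
    have "of_int m * pi / of_int n = of_int i * pi \<longleftrightarrow> real_of_int m = of_int (i * n)"
      using assms by (simp add: field_simps)
    then show ?thesis
      by (simp only: of_int_eq_iff)
  qed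
  then show ?thesis
    by (auto simp: sin_zero_iff_int2 dvd_def mult.commute)
qed

text \<open>Coprimality lets \<open>j\<close> be cancelled modulo \<open>n\<close>, which gives
  injectivity and keeps 0 out of the image; an injective self-map of a finite set is onto.\<close>

lemma bij_betw_mult_mod:
  fixes n j :: int
  assumes "n > 0" and "coprime j n"
  shows "bij_betw (\<lambda>m. j * m mod n) {1..n - 1} {1..n - 1}"
proof -
  let ?f = "\<lambda>m. j * m mod n"
  have inj: "inj_on ?f {1..n - 1}"
  proof (rule inj_onI)
    fix a b assume ab: "a \<in> {1..n - 1}" "b \<in> {1..n - 1}" "?f a = ?f b"
    then have "n dvd j * (a - b)"
      by (simp add: mod_eq_dvd_iff algebra_simps)
    then have "n dvd a - b"
      using assms(2) by (simp add: coprime_dvd_mult_right_iff coprime_commute)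
    then have "a mod n = b mod n"
      by (simp add: mod_eq_dvd_iff)
    \<comment> \<open>Both numbers lie strictly between 0 and \<open>n\<close>, so each is its own
      residue.\<close>
    with ab show "a = b" by simp
  qed
  have "?f ` {1..n - 1} \<subseteq> {1..n - 1}"
  proof clarify
    fix m assume m: "m \<in> {1..n - 1}"
    then have "\<not> n dvd m"
      using zdvd_not_zless by auto
    then have "\<not> n dvd j * m"
      using assms(2) by (simp add: coprime_dvd_mult_right_iff coprime_commute)
    then have "?f m \<noteq> 0" by (simp add: dvd_eq_mod_eq_0)
    moreover have "0 \<le> ?f m" "?f m < n" using assms(1) by simp_all
    ultimately show "?f m \<in> {1..n - 1}" by auto
  qed
  with inj show ?thesis
    by (simp add: bij_betw_def endo_inj_surj)
qed

text \<open>The odd members of \<open>{1..n - 1}\<close> are the \<open>2 * k + 1\<close>, and the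
  even ones are their reflections \<open>n - (2 * k + 1)\<close>, so both halves have the same sum.
  For \<open>n = 1\<close> the upper bound is -1 and both sums are empty.\<close>

lemma sum_odd_reflection:
  fixes n :: int and g :: "int \<Rightarrow> real"
  assumes "odd n" and refl: "\<And>m. g (n - m) = g m"
  shows "2 * (\<Sum>k = 0..(n - 3) div 2. g (2 * k + 1)) = (\<Sum>m = 1..n - 1. g m)"
proof -
  let ?K = "{0..(n - 3) div 2}"
  obtain r where r: "n = 2 * r + 1" using assms(1) by (rule oddE)
  have K: "?K = {0..r - 1}" using r by simp
  let ?O = "(\<lambda>k. 2 * k + 1) ` ?K" and ?E = "(\<lambda>k. n - (2 * k + 1)) ` ?K"
  have "{1..n - 1} = ?O \<union> ?E"
  proof (rule set_eqI)
    fix m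
    show "m \<in> {1..n - 1} \<longleftrightarrow> m \<in> ?O \<union> ?E"
    proof (cases "even m")
      case True
      then obtain s where "m = 2 * s" by (rule evenE)
      \<comment> \<open>Solving \<open>n - (2 * k + 1) = 2 * s\<close> gives the index
        \<open>k = r - s\<close>.\<close>
      moreover from this have "m = n - (2 * (r - s) + 1)" using r by simp
      ultimately show ?thesis unfolding K using r
        by (auto intro!: image_eqI[of _ _ "r - s"])
    next
      case False
      then obtain s where "m = 2 * s + 1" by (rule oddE)
      then show ?thesis unfolding K using r by (auto intro!: image_eqI[of _ _ s])
    qed
  qed
  moreover have "?O \<inter> ?E = {}"
  proof -
    \<comment> \<open>Parity: the left side is odd, while the right side is a difference of two odd
      numbers.\<close>
    have "2 * a + 1 \<noteq> n - (2 * b + 1)" for a b using r by presburger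
    then show ?thesis by auto
  qed
  ultimately have "(\<Sum>m = 1..n - 1. g m) = sum g ?O + sum g ?E"
    by (simp add: sum.union_disjoint)
  moreover have "sum g ?O = (\<Sum>k\<in>?K. g (2 * k + 1))"
    by (subst sum.reindex) (auto simp: inj_on_def)
  moreover have "sum g ?E = (\<Sum>k\<in>?K. g (2 * k + 1))"
    by (subst sum.reindex) (auto simp: inj_on_def refl simp del: of_int_diff)
  ultimately show ?thesis by simp
qed

theorem theorem2p4:
  fixes n j :: int
  assumes "n > 0" and "odd n" and "j > 0"
    and "gcd j n = 1"
    and "\<And>k. 0 \<le> k \<Longrightarrow> k \<le> (n - 3) div 2 \<Longrightarrow> \<not> n dvd j * (2 * k + 1)"
  shows "(\<Sum>k = 0..(n - 3) div 2.
            sin (real_of_int ((j - 1) * (2 * k + 1)) * pi / real_of_int n)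
              * sin (real_of_int ((j + 1) * (2 * k + 1)) * pi / real_of_int n)
            / ((sin (real_of_int (2 * k + 1) * pi / real_of_int n))\<^sup>2
              * (sin (real_of_int (j * (2 * k + 1)) * pi / real_of_int n))\<^sup>2)) = 0"
proof -
  let ?K = "{0..(n - 3) div 2}"
  \<comment> \<open>At multiples of \<open>n\<close> this is \<open>1 / 0 = 0\<close>, but no such
    argument occurs in the sums below.\<close>
  define F :: "int \<Rightarrow> real" where "F m = 1 / (sin (of_int m * pi / of_int n))\<^sup>2" for m
  have F_mod: "F (m mod n) = F m" for m
    using assms(1) by (simp add: F_def sin_squared_mod)
  have F_minus: "F (- m) = F m" for m
    by (simp add: F_def)
  \<comment> \<open>The free factor \<open>j'\<close> serves both sums: it becomes \<open>j\<close>
    for one and 1 for the other.\<close>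
  have F_reflect: "F (j' * (n - m)) = F (j' * m)" for j' m
  proof -
    have "j' * (n - m) mod n = - (j' * m) mod n"
      by (simp add: mod_eq_dvd_iff algebra_simps)
    then show ?thesis by (metis F_mod F_minus)
  qed
  have half: "2 * (\<Sum>k\<in>?K. F (j' * (2 * k + 1))) = (\<Sum>m = 1..n - 1. F (j' * m))" for j'
    using sum_odd_reflection[OF assms(2), of "\<lambda>m. F (j' * m)"] F_reflect by simp
  have "bij_betw (\<lambda>m. j * m mod n) {1..n - 1} {1..n - 1}"
    using assms(1,4) by (intro bij_betw_mult_mod) (simp_all add: coprime_iff_gcd_eq_1)
  then have "(\<Sum>m = 1..n - 1. F (j * m mod n)) = (\<Sum>m = 1..n - 1. F m)"
    by (rule sum.reindex_bij_betw)
  \<comment> \<open>Each side is half of a full residue sum, and the permutation by \<open>j\<close>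
    identifies the two full sums.\<close>
  then have "(\<Sum>k\<in>?K. F (j * (2 * k + 1))) = (\<Sum>k\<in>?K. F (2 * k + 1))"
    using half[of j] half[of 1] by (simp add: F_mod)
  moreover have
    "sin (real_of_int ((j - 1) * (2 * k + 1)) * pi / real_of_int n)
       * sin (real_of_int ((j + 1) * (2 * k + 1)) * pi / real_of_int n)
       / ((sin (real_of_int (2 * k + 1) * pi / real_of_int n))\<^sup>2
         * (sin (real_of_int (j * (2 * k + 1)) * pi / real_of_int n))\<^sup>2)
     = F (2 * k + 1) - F (j * (2 * k + 1))" if "k \<in> ?K" for k
  proof -
    define m where "m = 2 * k + 1"
    define A B where "A = real_of_int (j * m) * pi / real_of_int n"
      and "B = real_of_int m * pi / real_of_int n"
    \<comment> \<open>Both sines in the denominator are nonzero: a divisor \<open>n\<close> of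
      \<open>m\<close> would also divide \<open>j * m\<close>, which the hypothesis on
      \<open>k\<close> excludes.\<close>
    have ndvd: "\<not> n dvd j * m" using assms(5) that by (simp add: m_def)
    then have "\<not> n dvd m" by auto
    with ndvd have nz: "sin A \<noteq> 0" "sin B \<noteq> 0"
      using assms(1) unfolding A_def B_def by (subst sin_int_pi_div_eq_0_iff; simp)+
    have "real_of_int ((j - 1) * m) * pi / real_of_int n = A - B"
      "real_of_int ((j + 1) * m) * pi / real_of_int n = A + B"
      by (simp_all add: A_def B_def algebra_simps diff_divide_distrib add_divide_distrib)
    moreover have "sin (A - B) * sin (A + B) / ((sin B)\<^sup>2 * (sin A)\<^sup>2)
        = 1 / (sin B)\<^sup>2 - 1 / (sin A)\<^sup>2"
      using nz by (simp add: sin_diff_mult_sin_add field_simps)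
    ultimately show ?thesis
      unfolding m_def[symmetric] F_def A_def[symmetric] B_def[symmetric] by simp
  qed
  ultimately show ?thesis
    by (simp add: sum_subtractf del: of_int_mult of_int_add of_int_diff)
qed

end
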